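(* Assume that $\Sigma_0(\cdot,w,x',w')$ is continuous for all $w,w'\in W$ and $x'\in A$, that $\Sigma_0$ is bounded, and that $\mu_0$ is a constant. Suppose $\{A'_L\}_{L=1}^\infty$ is an increasing sequence of finite subsets of $A$ such that $\bigcup_{L=1}^\infty A'_L$ is dense in $A$. Then $$V_n(x_{n+1},w_{n+1})=\lim_{L\to\infty}\left(E_n\Big[\max_{x\in A'_L}\big(a_n(x)+\tilde\sigma_n(x,x_{n+1},w_{n+1})Z_{n+1}\big)\Big]-\max_{x\in A'_L}a_n(x)\right).$$
   Context: $A\subset\mathbb{R}^d$ is compact, $W$ is a subset of a Euclidean space, and $p:W\to[0,\infty)$ is an integrable density. $F$ has a Gaussian process prior on $A\times W$ with mean function $\mu_0$ and kernel $\Sigma_0$. Observing at $(x,w)$ yields $F(x,w)$ plus independent normal noise with mean $0$ and variance $\lambda_{(x,w)}\ge0$. $H_n$ is the history of the first $n$ sampled points and observations, $E_n$ is conditional expectation given $H_n$, and $\mu_n,\Sigma_n$ are the posterior mean function and covariance kernel of $F$ given $H_n$. $G(x)=\int F(x,w)p(w)\,dw$ and $a_n(x)=E_n[G(x)]=\int\mu_n(x,w)p(w)\,dw$. For the candidate next point $(x_{n+1},w_{n+1})\in A\times W$, $$\tilde\sigma_n(x,x_{n+1},w_{n+1})=\frac{\int\Sigma_n(x,w,x_{n+1},w_{n+1})p(w)\,dw}{\sqrt{\Sigma_n(x_{n+1},w_{n+1},x_{n+1},w_{n+1})+\lambda_{(x_{n+1},w_{n+1})}}}$$ (taken to be $0$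 if $\lambda_{(x_{n+1},w_{n+1})}=0$ and $(x_{n+1},w_{n+1})$ has already been sampled), and $Z_{n+1}$ is standard normal given $H_n$, with $a_{n+1}(x)=a_n(x)+\tilde\sigma_n(x,x_{n+1},w_{n+1})Z_{n+1}$. The value of information is $$V_n(x_{n+1},w_{n+1})=E_n\Big[\max_{x\in A}a_{n+1}(x)\,\Big|\,x_{n+1},w_{n+1}\Big]-\max_{x\in A}a_n(x).$$ *)

theory Defs
  imports "HOL-Probability.Probability"
begin

section \<open>Gaussian laws and Gaussian processes\<close>

text \<open>The normal law with mean m and variance v; variance 0 (a point mass) is allowed, since
  Gaussian processes and noise may be degenerate.\<close>

definition normal_law :: "real \<Rightarrow> real \<Rightarrow> real measure" where
  "normal_law m v =
     (if v = 0 then return borel m else density lborel (\<lambda>x. ennreal (normal_density m (sqrt v) x)))"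

definition covariance_kernel :: "'t set \<Rightarrow> ('t \<Rightarrow> 't \<Rightarrow> real) \<Rightarrow> bool" where
  "covariance_kernel T K \<longleftrightarrow>
     (\<forall>s\<in>T. \<forall>t\<in>T. K s t = K t s) \<and>
     (\<forall>S c. finite S \<and> S \<subseteq> T \<longrightarrow> 0 \<le> (\<Sum>s\<in>S. \<Sum>t\<in>S. c s * c t * K s t))"

text \<open>Gaussian process: every finite linear combination of its values is normal, with the
  mean and variance dictated by the mean function and the kernel.\<close>

definition gaussian_process ::
  "'c measure \<Rightarrow> 't set \<Rightarrow> ('t \<Rightarrow> 'c \<Rightarrow> real) \<Rightarrow> ('t \<Rightarrow> real) \<Rightarrow> ('t \<Rightarrow> 't \<Rightarrow> real) \<Rightarrow> bool" where
  "gaussian_process M T F m K \<longleftrightarrow>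
     covariance_kernel T K \<and>
     (\<forall>t\<in>T. F t \<in> borel_measurable M) \<and>
     (\<forall>S c. finite S \<and> S \<subseteq> T \<longrightarrow>
        distr M borel (\<lambda>\<omega>. \<Sum>s\<in>S. c s * F s \<omega>) =
          normal_law (\<Sum>s\<in>S. c s * m s) (\<Sum>s\<in>S. \<Sum>t\<in>S. c s * c t * K s t))"

text \<open>The real random variable Y has conditional law \<kappa> given the sub-sigma-algebra N.\<close>

definition has_cond_law ::
  "'c measure \<Rightarrow> 'c measure \<Rightarrow> ('c \<Rightarrow> real) \<Rightarrow> ('c \<Rightarrow> real measure) \<Rightarrow> bool" where
  "has_cond_law M N Y \<kappa> \<longleftrightarrow>
     Y \<in> borel_measurable M \<and>
     (\<forall>U\<in>sets borel. AE \<omega> in M.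
        real_cond_exp M N (\<lambda>\<omega>'. indicator U (Y \<omega>')) \<omega> = measure (\<kappa> \<omega>) U)"

text \<open>F is a Gaussian process conditionally on N, with random mean function m and kernel K.\<close>

definition gaussian_process_given ::
  "'c measure \<Rightarrow> 'c measure \<Rightarrow> 't set \<Rightarrow> ('t \<Rightarrow> 'c \<Rightarrow> real) \<Rightarrow>
   ('c \<Rightarrow> 't \<Rightarrow> real) \<Rightarrow> ('c \<Rightarrow> 't \<Rightarrow> 't \<Rightarrow> real) \<Rightarrow> bool" where
  "gaussian_process_given M N T F m K \<longleftrightarrow>
     (\<forall>\<omega>\<in>space M. covariance_kernel T (K \<omega>)) \<and>
     (\<forall>t\<in>T. F t \<in> borel_measurable M) \<and>
     (\<forall>S c. finite S \<and> S \<subseteq> T \<longrightarrow>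
        has_cond_law M N (\<lambda>\<omega>. \<Sum>s\<in>S. c s * F s \<omega>)
          (\<lambda>\<omega>. normal_law (\<Sum>s\<in>S. c s * m \<omega> s) (\<Sum>s\<in>S. \<Sum>t\<in>S. c s * c t * K \<omega> s t)))"

section \<open>Gaussian process regression\<close>

text \<open>Posterior kernel and mean after the first n observations y 0, ..., y (n - 1) at the points
  d 0, ..., d (n - 1) with noise variances lam, obtained by conditioning on one observation at a
  time.  If the Gram matrix of the sampled points plus the diagonal noise matrix is invertible,
  this is the usual formula with the inverse of that matrix.  The sequential form also covers
  the singular case (e.g. a point sampled again without noise): the observation then has
  predictive variance 0, carries no information, and the update is void because x / 0 = 0.\<close>

fun post_cov :: "('t \<Rightarrow> 't \<Rightarrow> real) \<Rightarrow> ('t \<Rightarrow> real) \<Rightarrow> (nat \<Rightarrow> 't) \<Rightarrow> nat \<Rightarrow> 't \<Rightarrow> 't \<Rightarrow> real" where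
  "post_cov K lam d 0 u v = K u v"
| "post_cov K lam d (Suc n) u v =
     post_cov K lam d n u v -
     post_cov K lam d n u (d n) * post_cov K lam d n (d n) v /
       (post_cov K lam d n (d n) (d n) + lam (d n))"

fun post_mean :: "('t \<Rightarrow> real) \<Rightarrow> ('t \<Rightarrow> 't \<Rightarrow> real) \<Rightarrow> ('t \<Rightarrow> real) \<Rightarrow> (nat \<Rightarrow> 't) \<Rightarrow> (nat \<Rightarrow> real) \<Rightarrow>
    nat \<Rightarrow> 't \<Rightarrow> real" where
  "post_mean m K lam d y 0 u = m u"
| "post_mean m K lam d y (Suc n) u =
     post_mean m K lam d y n u +
     post_cov K lam d n u (d n) / (post_cov K lam d n (d n) (d n) + lam (d n)) *
       (y n - post_mean m K lam d y n (d n))"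

section \<open>Sigma-algebras of the observation scheme\<close>

text \<open>The history of the first n sampled points X i and observations Y i.\<close>

definition history :: "'c measure \<Rightarrow> (nat \<Rightarrow> 'c \<Rightarrow> 't::topological_space) \<Rightarrow> (nat \<Rightarrow> 'c \<Rightarrow> real) \<Rightarrow>
    nat \<Rightarrow> 'c measure" where
  "history M X Y n =
     vimage_algebra (space M) (\<lambda>\<omega>. \<lambda>i\<in>{..<n}. (X i \<omega>, Y i \<omega>)) (PiM {..<n} (\<lambda>_. borel \<Otimes>\<^sub>M borel))"

text \<open>What the noise at step i must be independent of: the process F, the sampled points up to
  and including step i, and the earlier noise.\<close>

definition before_noise :: "'c measure \<Rightarrow> 't set \<Rightarrow> ('t \<Rightarrow> 'c \<Rightarrow> real) \<Rightarrow>
    (nat \<Rightarrow> 'c \<Rightarrow> 't::topological_space) \<Rightarrow> (nat \<Rightarrow> 'c \<Rightarrow> real) \<Rightarrow> nat \<Rightarrow> 'c measure" where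
  "before_noise M T F X e i =
     vimage_algebra (space M)
       (\<lambda>\<omega>. (\<lambda>t\<in>T. F t \<omega>, \<lambda>j\<in>{..i}. X j \<omega>, \<lambda>j\<in>{..<i}. e j \<omega>))
       (PiM T (\<lambda>_. borel) \<Otimes>\<^sub>M PiM {..i} (\<lambda>_. borel) \<Otimes>\<^sub>M PiM {..<i} (\<lambda>_. borel))"

section \<open>Maximum of a function over a set\<close>

definition max_over :: "'t set \<Rightarrow> ('t \<Rightarrow> real) \<Rightarrow> real" where
  "max_over S f = (GREATEST y. y \<in> f ` S)"

end

theory Submission
  imports Defs
begin

text \<open>The posterior mean and kernel are, in their first argument, finite combinations of kernel
  sections, hence bounded and continuous in x; so a and \<sigma> are continuous in x, and the
  almost sure update formula, valid on the countable dense set of candidates, extends to A.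
  The maxima over A' L increase to the maximum over A, and they are dominated by
  s (1 + |Z|), where s is a maximum over A that depends on the history only.  The random weights
  of the observations need not be integrable, so conditional monotone convergence is applied on
  the history events where s is bounded.\<close>

section \<open>Maxima\<close>

text \<open>For a fixed outcome the posterior is bounded over all of \<open>A \<times> W\<close>,
  but the bound varies with the outcome: the sampled points are random, and the predictive variances
  in the denominators of the weights may be arbitrarily small. So there are two separate limit
  arguments. For one outcome, dominated convergence in \<open>w\<close> with a constant dominating
  function gives continuity in \<open>x\<close>, because integrating against \<open>p\<close> is
  integrating against a finite measure. Across outcomes only a random bound is available.
  Measurability needs as much care as convergence. A maximum over the uncountable set
  \<open>A\<close> is measurable as a limit of maxima over the \<open>A' L\<close>. The set
  \<open>W\<close> may fail to be measurable, so integrals over it are rewritten with a finite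
  measure on the Borel sets of \<open>W\<close>; the posterior is jointly measurable for that
  product structure, and its integrals become measurable in the outcome.\<close>

lemma max_over_eqI:
  assumes "y \<in> f ` S" and "\<And>x. x \<in> S \<Longrightarrow> f x \<le> y"
  shows "max_over S f = y"
  unfolding max_over_def using assms by (intro Greatest_equality) auto

lemma max_over_attained:
  fixes f :: "'a::topological_space \<Rightarrow> real"
  assumes "compact S" "S \<noteq> {}" "continuous_on S f"
  obtains x where "x \<in> S" "max_over S f = f x" "\<And>y. y \<in> S \<Longrightarrow> f y \<le> f x"
proof -
  from continuous_attains_sup[OF assms] obtain x where x: "x \<in> S" "\<And>y. y \<in> S \<Longrightarrow> f y \<le> f x"
    by blast
  moreover from x have "max_over S f = f x" by (intro max_over_eqI) auto
  ultimately show ?thesis using that by blast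
qed

lemma max_over_cong: "(\<And>x. x \<in> S \<Longrightarrow> f x = g x) \<Longrightarrow> max_over S f = max_over S g"
  unfolding max_over_def by (metis image_cong)

lemma max_over_finite_attained:
  fixes f :: "'a \<Rightarrow> real"
  assumes "finite S" "S \<noteq> {}"
  obtains x where "x \<in> S" "max_over S f = f x" "\<And>y. y \<in> S \<Longrightarrow> f y \<le> f x"
proof -
  have "Max (f ` S) \<in> f ` S" using assms by (intro Max_in) auto
  then obtain x where x: "x \<in> S" "f x = Max (f ` S)" by auto
  have le: "\<And>y. y \<in> S \<Longrightarrow> f y \<le> f x" using x assms by auto
  moreover have "max_over S f = f x" using imageI[OF x(1), of f] le by (rule max_over_eqI)
  ultimately show ?thesis using that x(1) by blast
qed

lemma max_over_eq_Max:
  fixes f :: "'a \<Rightarrow> real"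
  assumes "finite S" "S \<noteq> {}"
  shows "max_over S f = Max (f ` S)"
  using assms by (intro max_over_eqI Max_in) auto

lemma max_over_mono_set:
  fixes f :: "'a \<Rightarrow> real"
  assumes "finite T" "S \<subseteq> T" "S \<noteq> {}"
  shows "max_over S f \<le> max_over T f"
proof -
  have "finite S" "T \<noteq> {}" using assms by (auto intro: finite_subset)
  then show ?thesis using assms by (simp add: max_over_eq_Max Max_mono image_mono del: Max_le_iff)
qed

text \<open>Some point of the union lies so close to a maximiser that its value is within
  \<open>e\<close> of the maximum. As the sets increase, it belongs to all later \<open>A' L\<close>
  and squeezes their maxima. Since that point also witnesses non-emptiness, finitely many of the
  \<open>A' L\<close> may be empty.\<close>

lemma max_over_dense_tendsto:
  fixes f :: "'a::metric_space \<Rightarrow> real"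
  assumes A: "compact A" "A \<noteq> {}" and f: "continuous_on A f"
    and fin: "\<And>L. finite (A' L)" and sub: "\<And>L. A' L \<subseteq> A" and inc: "incseq A'"
    and dense: "A \<subseteq> closure (\<Union>L. A' L)"
  shows "(\<lambda>L. max_over (A' L) f) \<longlonglongrightarrow> max_over A f"
proof (rule LIMSEQ_I)
  fix e :: real assume e: "e > 0"
  obtain x where x: "x \<in> A" "max_over A f = f x" "\<And>y. y \<in> A \<Longrightarrow> f y \<le> f x"
    using max_over_attained[OF A f] by blast
  obtain d where d: "d > 0" "\<And>y. y \<in> A \<Longrightarrow> dist y x < d \<Longrightarrow> dist (f y) (f x) < e"
    using f e x(1) unfolding continuous_on_iff by meson
  obtain y where y: "y \<in> (\<Union>L. A' L)" "dist y x < d"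
    using dense x(1) d(1) by (meson closure_approachable subsetD)
  then obtain L0 where L0: "y \<in> A' L0" by auto
  have "norm (max_over (A' L) f - max_over A f) < e" if "L \<ge> L0" for L
  proof -
    have yL: "y \<in> A' L" using L0 inc that by (auto simp: incseq_def)
    then obtain v where v: "v \<in> A' L" "max_over (A' L) f = f v" "\<And>y. y \<in> A' L \<Longrightarrow> f y \<le> f v"
      using max_over_finite_attained[OF fin] by (metis empty_iff)
    have "f y \<le> f v" using v yL by auto
    moreover have "f v \<le> f x" using v x sub by auto
    moreover have "dist (f y) (f x) < e" using d(2)[of y] y yL sub by auto
    ultimately show ?thesis using v x by (auto simp: dist_real_def)
  qed
  then show "\<exists>no. \<forall>n\<ge>no. norm (max_over (A' n) f - max_over A f) < e" by blast
qed

lemma measurable_max_over_finite: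
  fixes f :: "'c \<Rightarrow> 'a \<Rightarrow> real"
  assumes "finite S" and f: "\<And>x. x \<in> S \<Longrightarrow> (\<lambda>\<omega>. f \<omega> x) \<in> borel_measurable N"
  shows "(\<lambda>\<omega>. max_over S (f \<omega>)) \<in> borel_measurable N"
proof (cases "S = {}")
  \<comment> \<open>Over the empty set \<open>max_over\<close> is an unspecified value, but one that
    does not depend on \<open>\<omega>\<close>.\<close>
  case True
  then show ?thesis by (simp add: max_over_def)
next
  case False
  have "(\<lambda>\<omega>. Max ((\<lambda>x. f \<omega> x) ` S)) \<in> borel_measurable N"
    by (rule borel_measurable_Max[OF assms(1)]) (rule f)
  then show ?thesis using False assms(1) by (simp add: max_over_eq_Max)
qed

text \<open>Continuity reduces the maximum over an uncountable set to a pointwise limit of finite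
  maxima, which are measurable.\<close>

lemma measurable_max_over_compact:
  fixes f :: "'c \<Rightarrow> 'a::metric_space \<Rightarrow> real"
  assumes A: "compact A" "A \<noteq> {}"
    and fin: "\<And>L. finite (A' L)" and sub: "\<And>L. A' L \<subseteq> A" and inc: "incseq A'"
    and dense: "A \<subseteq> closure (\<Union>L. A' L)"
    and cont: "\<And>\<omega>. \<omega> \<in> space N \<Longrightarrow> continuous_on A (f \<omega>)"
    and meas: "\<And>x. x \<in> A \<Longrightarrow> (\<lambda>\<omega>. f \<omega> x) \<in> borel_measurable N"
  shows "(\<lambda>\<omega>. max_over A (f \<omega>)) \<in> borel_measurable N"
proof (rule borel_measurable_LIMSEQ_real)
  show "(\<lambda>L. max_over (A' L) (f \<omega>)) \<longlonglongrightarrow> max_over A (f \<omega>)" if "\<omega> \<in> space N" for \<omega>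
    using max_over_dense_tendsto[OF A cont[OF that] fin sub inc dense] .
  show "(\<lambda>\<omega>. max_over (A' L) (f \<omega>)) \<in> borel_measurable N" for L
    using sub meas by (intro measurable_max_over_finite fin) auto
qed

section \<open>Conditional expectations\<close>

text \<open>Total expectation turns convergence of the integrals into L1 convergence of the
  conditional expectations, hence almost sure convergence along a subsequence. The conditional
  expectations themselves increase almost surely, so the whole sequence has the limit of the
  subsequence.\<close>

lemma (in sigma_finite_subalgebra) real_cond_exp_incseq_tendsto:
  assumes u: "\<And>i. integrable M (u i)" and f: "integrable M f"
    and mono: "\<And>x. x \<in> space M \<Longrightarrow> incseq (\<lambda>i. u i x)"
    and lim: "\<And>x. x \<in> space M \<Longrightarrow> (\<lambda>i. u i x) \<longlonglongrightarrow> f x"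
  shows "AE x in M. (\<lambda>i. real_cond_exp M F (u i) x) \<longlonglongrightarrow> real_cond_exp M F f x"
proof -
  define D where "D = (\<lambda>i x. real_cond_exp M F (u i) x - real_cond_exp M F f x)"
  have uf: "u i x \<le> f x" if "x \<in> space M" for i x
    using incseq_le[OF mono[OF that] lim[OF that]] .
  have le: "AE x in M. real_cond_exp M F (u i) x \<le> real_cond_exp M F f x" for i
    by (rule real_cond_exp_mono[OF AE_I2 u f]) (rule uf)
  have inc: "AE x in M. real_cond_exp M F (u i) x \<le> real_cond_exp M F (u (Suc i)) x" for i
    by (rule real_cond_exp_mono[OF AE_I2 u u]) (use mono in \<open>auto simp: incseq_Suc_iff\<close>)
  have intD: "integrable M (D i)" for i
    unfolding D_def using u f by (intro Bochner_Integration.integrable_diff real_cond_exp_int(1))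
  \<comment> \<open>Almost surely \<open>D i\<close> is not positive, so its norm is a difference
    without absolute value, and conditioning preserves each integral.\<close>
  have "(\<integral>x. norm (D i x) \<partial>M) = (\<integral>x. f x \<partial>M) - (\<integral>x. u i x \<partial>M)" for i
  proof -
    have "(\<integral>x. norm (D i x) \<partial>M) = (\<integral>x. real_cond_exp M F f x - real_cond_exp M F (u i) x \<partial>M)"
      unfolding D_def using le[of i] by (intro integral_cong_AE) auto
    also have "\<dots> = (\<integral>x. f x \<partial>M) - (\<integral>x. u i x \<partial>M)"
      using u f real_cond_exp_int by (subst Bochner_Integration.integral_diff) auto
    finally show ?thesis .
  qed
  moreover have "(\<lambda>i. (\<integral>x. u i x \<partial>M)) \<longlonglongrightarrow> (\<integral>x. f x \<partial>M)"
  \<comment> \<open>All terms lie between \<open>u 0\<close> and \<open>f\<close>.\<close>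
  proof (rule integral_dominated_convergence[where w = "\<lambda>x. \<bar>f x\<bar> + \<bar>u 0 x\<bar>"])
    show "integrable M (\<lambda>x. \<bar>f x\<bar> + \<bar>u 0 x\<bar>)" using u f by auto
    have "u 0 x \<le> u i x \<and> u i x \<le> f x" if "x \<in> space M" for i x
      using uf[OF that] mono[OF that] by (auto simp: incseq_def)
    then show "AE x in M. norm (u i x) \<le> \<bar>f x\<bar> + \<bar>u 0 x\<bar>" for i
      by (intro AE_I2) (smt (verit) real_norm_def)
  qed (use u f lim in auto)
  then have "(\<lambda>i. (\<integral>x. f x \<partial>M) - (\<integral>x. u i x \<partial>M)) \<longlonglongrightarrow> (\<integral>x. f x \<partial>M) - (\<integral>x. f x \<partial>M)"
    by (intro tendsto_intros)
  ultimately have "(\<lambda>i. (\<integral>x. norm (D i x) \<partial>M)) \<longlonglongrightarrow> 0" by simp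
  from tendsto_L1_AE_subseq[OF intD this] obtain r :: "nat \<Rightarrow> nat"
    where r: "strict_mono r" "AE x in M. (\<lambda>n. D (r n) x) \<longlonglongrightarrow> 0" by blast
  have "AE x in M. \<forall>i. real_cond_exp M F (u i) x \<le> real_cond_exp M F f x" using le by (simp add: AE_all_countable)
  moreover have "AE x in M. \<forall>i. real_cond_exp M F (u i) x \<le> real_cond_exp M F (u (Suc i)) x"
    using inc by (simp add: AE_all_countable)
  ultimately show ?thesis using r(2)
  proof eventually_elim
    case (elim x)
    have incs: "incseq (\<lambda>i. real_cond_exp M F (u i) x)" using elim(2) by (simp add: incseq_Suc_iff)
    then obtain l where l: "(\<lambda>i. real_cond_exp M F (u i) x) \<longlonglongrightarrow> l"
      using incseq_convergent[OF incs] elim(1) by blast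
    have "(\<lambda>n. D (r n) x + real_cond_exp M F f x) \<longlonglongrightarrow> 0 + real_cond_exp M F f x"
      by (intro tendsto_intros elim(3))
    then have "(\<lambda>n. real_cond_exp M F (u (r n)) x) \<longlonglongrightarrow> real_cond_exp M F f x" by (simp add: D_def)
    moreover have "(\<lambda>n. real_cond_exp M F (u (r n)) x) \<longlonglongrightarrow> l"
      using LIMSEQ_subseq_LIMSEQ[OF l r(1)] by (simp add: o_def)
    ultimately show ?case using l LIMSEQ_unique by blast
  qed
qed

text \<open>The dominating function need not be integrable, only a product of an F-measurable and an
  integrable one: on the F-measurable sets where the first factor is bounded the integrable case
  applies, and these sets exhaust the space.\<close>

lemma (in sigma_finite_subalgebra) real_cond_exp_incseq_tendsto_local:
  assumes u: "\<And>i. u i \<in> borel_measurable M"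
    and mono: "\<And>x. x \<in> space M \<Longrightarrow> incseq (\<lambda>i. u i x)"
    and lim: "\<And>x. x \<in> space M \<Longrightarrow> (\<lambda>i. u i x) \<longlonglongrightarrow> f x"
    and c: "c \<in> borel_measurable F" and G: "integrable M G" "\<And>x. x \<in> space M \<Longrightarrow> 0 \<le> G x"
    and bound: "\<And>i x. x \<in> space M \<Longrightarrow> \<bar>u i x\<bar> \<le> c x * G x"
  shows "AE x in M. (\<lambda>i. real_cond_exp M F (u i) x) \<longlonglongrightarrow> real_cond_exp M F f x"
proof -
  define B where "B = (\<lambda>m::nat. {x \<in> space F. c x \<le> real m})"
  have sp: "space F = space M" using subalg by (simp add: subalgebra_def)
  have BF: "B m \<in> sets F" for m unfolding B_def using c by measurable
  then have BM: "B m \<in> sets M" for m using subalg by (auto simp: subalgebra_def)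
  have f: "f \<in> borel_measurable M" using borel_measurable_LIMSEQ_real[OF lim u] .
  have fbound: "\<bar>f x\<bar> \<le> c x * G x" if "x \<in> space M" for x
    by (rule LIMSEQ_le_const2[OF tendsto_rabs[OF lim[OF that]]]) (use bound[OF that] in auto)
  have int: "integrable M (\<lambda>x. indicator (B m) x * g x)"
    if g: "g \<in> borel_measurable M" "\<And>x. x \<in> space M \<Longrightarrow> \<bar>g x\<bar> \<le> c x * G x" for g m
  proof (rule Bochner_Integration.integrable_bound[of M "\<lambda>x. real m * G x"])
    show "integrable M (\<lambda>x. real m * G x)" using G by auto
    show "(\<lambda>x. indicator (B m) x * g x) \<in> borel_measurable M" using g BM by measurable
    have "\<bar>g x\<bar> \<le> \<bar>real m * G x\<bar>" if "x \<in> space M" "x \<in> B m" for x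
    proof -
      have "c x * G x \<le> real m * G x" using that G(2) by (intro mult_right_mono) (auto simp: B_def)
      then show ?thesis using g(2)[OF that(1)] by linarith
    qed
    then show "AE x in M. norm (indicator (B m) x * g x) \<le> norm (real m * G x)"
      by (intro AE_I2) (auto simp: indicator_def)
  qed
  have "AE x in M. x \<in> B m \<longrightarrow> (\<lambda>i. real_cond_exp M F (u i) x) \<longlonglongrightarrow> real_cond_exp M F f x" for m
  proof -
    have "AE x in M. (\<lambda>i. real_cond_exp M F (\<lambda>x. indicator (B m) x * u i x) x)
        \<longlonglongrightarrow> real_cond_exp M F (\<lambda>x. indicator (B m) x * f x) x"
    proof (rule real_cond_exp_incseq_tendsto)
      show "incseq (\<lambda>i. indicator (B m) x * u i x)" if "x \<in> space M" for x
        using mono[OF that] by (auto simp: incseq_def indicator_def)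
      show "(\<lambda>i. indicator (B m) x * u i x) \<longlonglongrightarrow> indicator (B m) x * f x" if "x \<in> space M" for x
        using lim[OF that] by (intro tendsto_intros)
    qed (use int u f bound fbound in auto)
    \<comment> \<open>The indicator can be pulled out as soon as the product is integrable;
      \<open>u i\<close> and \<open>f\<close> alone need not be. For them
      \<open>real_cond_exp\<close> is still defined, from the extended conditional expectations of
      the positive and negative parts.\<close>
    moreover have "AE x in M. \<forall>i. real_cond_exp M F (\<lambda>x. indicator (B m) x * u i x) x
        = indicator (B m) x * real_cond_exp M F (u i) x"
      unfolding AE_all_countable using u BF int[OF u bound] by (intro allI real_cond_exp_mult) auto
    moreover have "AE x in M. real_cond_exp M F (\<lambda>x. indicator (B m) x * f x) x
        = indicator (B m) x * real_cond_exp M F f x"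
      using f BF int[OF f fbound] by (intro real_cond_exp_mult) auto
    ultimately show ?thesis by eventually_elim auto
  qed
  then have "AE x in M. \<forall>m. x \<in> B m \<longrightarrow> (\<lambda>i. real_cond_exp M F (u i) x) \<longlonglongrightarrow> real_cond_exp M F f x"
    unfolding AE_all_countable by blast
  then show ?thesis
  proof (rule AE_mp, intro AE_I2 impI)
    fix x assume "x \<in> space M" and
      *: "\<forall>m. x \<in> B m \<longrightarrow> (\<lambda>i. real_cond_exp M F (u i) x) \<longlonglongrightarrow> real_cond_exp M F f x"
    moreover obtain m where "c x \<le> real m" using real_arch_simple by blast
    ultimately show "(\<lambda>i. real_cond_exp M F (u i) x) \<longlonglongrightarrow> real_cond_exp M F f x"
      by (auto simp: B_def sp)
  qed
qed

text \<open>Integrating the conditional probability of \<open>U\<close> returns its probability, and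
  the integrand is the constant \<open>measure \<kappa> U\<close> almost surely.\<close>

lemma (in prob_space) has_cond_law_const_distr:
  assumes sub: "subalgebra M N" and Y: "has_cond_law M N Y (\<lambda>_. \<kappa>)"
    and \<kappa>: "prob_space \<kappa>" "sets \<kappa> = sets borel"
  shows "distr M borel Y = \<kappa>"
proof -
  interpret finite_measure_subalgebra M N
    using sub by (simp add: finite_measure_subalgebra_def finite_measure_subalgebra_axioms_def finite_measure_axioms)
  interpret \<kappa>: prob_space \<kappa> by fact
  have Ym[measurable]: "Y \<in> borel_measurable M" using Y by (simp add: has_cond_law_def)
  show ?thesis
  proof (rule measure_eqI)
    show "sets (distr M borel Y) = sets \<kappa>" by (simp add: \<kappa>)
    fix U assume "U \<in> sets (distr M borel Y)"
    then have U[measurable]: "U \<in> sets borel" by simp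
    have int: "integrable M (\<lambda>\<omega>. indicator U (Y \<omega>) :: real)"
      by (rule integrable_const_bound[where B=1]) (auto simp: indicator_def)
    have "prob (Y -` U \<inter> space M) = (\<integral>\<omega>. indicator U (Y \<omega>) \<partial>M)"
    proof -
      have "(\<integral>\<omega>. indicator U (Y \<omega>) \<partial>M) = (\<integral>\<omega>. indicator (Y -` U \<inter> space M) \<omega> \<partial>M)"
        by (intro Bochner_Integration.integral_cong) (auto simp: indicator_def)
      also have "\<dots> = prob (Y -` U \<inter> space M)" by simp
      finally show ?thesis by (rule sym)
    qed
    also have "\<dots> = (\<integral>\<omega>. real_cond_exp M N (\<lambda>\<omega>'. indicator U (Y \<omega>')) \<omega> \<partial>M)"
      by (rule real_cond_exp_int(2)[OF int, symmetric])
    also have "\<dots> = (\<integral>\<omega>. measure \<kappa> U \<partial>M)"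
      using Y U by (intro integral_cong_AE) (auto simp: has_cond_law_def)
    also have "\<dots> = measure \<kappa> U" by (simp add: prob_space)
    finally have "prob (Y -` U \<inter> space M) = measure \<kappa> U" .
    then show "emeasure (distr M borel Y) U = emeasure \<kappa> U"
      by (simp add: emeasure_distr emeasure_eq_measure \<kappa>.emeasure_eq_measure)
  qed
qed

text \<open>The standard normal law has a finite first moment. This makes \<open>1 + |Z|\<close> an
  admissible dominating factor.\<close>

lemma (in prob_space) integrable_cond_std_normal:
  assumes "subalgebra M N" and "has_cond_law M N Z (\<lambda>_. normal_law 0 1)"
  shows "integrable M Z"
proof -
  have nl: "normal_law 0 1 = density lborel std_normal_density" by (simp add: normal_law_def)
  have "distr M borel Z = density lborel std_normal_density"
    using has_cond_law_const_distr[OF assms] prob_space_normal_density[of 1 0] by (simp add: nl)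
  moreover have "integrable (density lborel std_normal_density) (\<lambda>x. x)"
    using integrable_std_normal_moment[of 1] by (simp add: integrable_density normal_density_nonneg)
  ultimately have "integrable (distr M borel Z) (\<lambda>x. x)" by (simp only:)
  then show ?thesis by (rule integrable_distr[rotated]) (use assms(2) in \<open>simp add: has_cond_law_def\<close>)
qed

section \<open>Integration against a density\<close>

text \<open>W itself need not be Lebesgue measurable, but the part of W where p is positive is; the
  rest of W is sent to an arbitrary point of it.\<close>

lemma density_measure_exists:
  fixes p :: "'b::euclidean_space \<Rightarrow> real"
  assumes w0: "w0 \<in> W" and nonneg: "\<And>w. w \<in> W \<Longrightarrow> 0 \<le> p w"
    and int: "set_integrable lebesgue W p"
  obtains P where "finite_measure P" "sets P = sets (restrict_space borel W)"
    "\<And>\<phi>. \<phi> \<in> borel_measurable (restrict_space borel W) \<Longrightarrow>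
       (LINT w:W|lebesgue. \<phi> w * p w) = (\<integral>w. \<phi> w \<partial>P)"
proof -
  define g where "g = (\<lambda>w. indicator W w * p w)"
  define S where "S = {w. g w > 0}"
  define h where "h = (\<lambda>w. if w \<in> S then w else w0)"
  define \<nu> where "\<nu> = density lebesgue (\<lambda>w. ennreal (g w))"
  \<comment> \<open>The push-forward leaves Lebesgue sets for Borel sets of \<open>W\<close>,
    because the kernel is only assumed Borel measurable jointly in its arguments.\<close>
  define P where "P = distr \<nu> (restrict_space borel W) h"
  have gi: "integrable lebesgue g" using int by (simp add: set_integrable_def g_def)
  then have gm[measurable]: "g \<in> borel_measurable lebesgue" by auto
  have g0: "0 \<le> g w" for w using nonneg by (simp add: g_def indicator_def)
  \<comment> \<open>Integrability of \<open>p\<close> over \<open>W\<close> makes the product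
    \<open>g\<close> measurable even when \<open>W\<close> is not, and \<open>S\<close> is cut out
    by \<open>g\<close>.\<close>
  have "{w \<in> space lebesgue. g w > 0} \<in> sets lebesgue" by measurable
  then have S[measurable]: "S \<in> sets lebesgue" by (simp add: S_def)
  have SW: "S \<subseteq> W" by (auto simp: S_def g_def indicator_def split: if_splits)
  have id: "(\<lambda>w. w) \<in> measurable lebesgue (borel :: 'b measure)"
    by (rule measurable_completion) simp
  have "h \<in> measurable lebesgue borel"
    unfolding h_def by (rule measurable_If_set[OF id]) (use S in auto)
  then have h: "h \<in> measurable lebesgue (restrict_space borel W)"
    using SW w0 by (intro measurable_restrict_space2) (auto simp: h_def)
  have "(\<integral>\<^sup>+w. ennreal (g w) \<partial>lebesgue) < \<infinity>"
    using gi g0 by (simp add: nn_integral_eq_integral)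
  then have "emeasure \<nu> (space \<nu>) \<noteq> \<infinity>" by (simp add: \<nu>_def emeasure_density)
  then interpret \<nu>: finite_measure \<nu> by (rule finite_measureI)
  have h\<nu>: "h \<in> measurable \<nu> (restrict_space borel W)" using h by (simp add: \<nu>_def)
  show thesis
  proof
    show "finite_measure P" unfolding P_def by (rule \<nu>.finite_measure_distr[OF h\<nu>])
    show "sets P = sets (restrict_space borel W)" by (simp add: P_def)
    fix \<phi> :: "'b \<Rightarrow> real" assume \<phi>: "\<phi> \<in> borel_measurable (restrict_space borel W)"
    have m: "(\<lambda>w. \<phi> (h w)) \<in> borel_measurable lebesgue" using measurable_compose[OF h \<phi>] .
    have "(\<integral>w. \<phi> w \<partial>P) = (\<integral>w. \<phi> (h w) \<partial>\<nu>)" unfolding P_def by (rule integral_distr[OF h\<nu> \<phi>])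
    also have "\<dots> = (\<integral>w. g w *\<^sub>R \<phi> (h w) \<partial>lebesgue)"
      unfolding \<nu>_def by (rule integral_density[OF m]) (use g0 in auto)
    also have "\<dots> = (LINT w:W|lebesgue. \<phi> w * p w)"
      unfolding set_lebesgue_integral_def
    proof (intro Bochner_Integration.integral_cong refl)
      fix w
      show "g w *\<^sub>R \<phi> (h w) = indicator W w *\<^sub>R (\<phi> w * p w)"
      proof (cases "w \<in> S")
        \<comment> \<open>Outside \<open>S\<close> the density \<open>g\<close> vanishes, so the
          value of \<open>\<phi>\<close> at \<open>w0\<close> contributes nothing.\<close>
        case False
        then have "g w = 0" using g0[of w] by (auto simp: S_def)
        then show ?thesis by (auto simp: g_def)
      qed (auto simp: h_def g_def)
    qed
    finally show "(LINT w:W|lebesgue. \<phi> w * p w) = (\<integral>w. \<phi> w \<partial>P)" by simp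
  qed
qed

text \<open>These conditions are what dominated convergence in \<open>w\<close> asks for, and they
  survive the regression recursion. Continuity is required in \<open>x\<close> only, for each fixed
  \<open>w\<close>, just as it is assumed of the prior kernel.\<close>

definition regular_on :: "'a::euclidean_space set \<Rightarrow> 'b::euclidean_space set \<Rightarrow> ('a \<times> 'b \<Rightarrow> real) \<Rightarrow> bool" where
  "regular_on A W f \<longleftrightarrow> bounded (f ` (A \<times> W)) \<and> (\<forall>w\<in>W. continuous_on A (\<lambda>x. f (x, w))) \<and>
     f \<in> borel_measurable (restrict_space borel (A \<times> W))"

text \<open>The shape \<open>f + c * g\<close> is that of one regression update, seen as a function
  of the point of prediction.\<close>

lemma regular_on_lincomb:
  assumes "regular_on A W f" "regular_on A W g"
  shows "regular_on A W (\<lambda>u. f u + c * g u)"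
proof -
  have [measurable]: "f \<in> borel_measurable (restrict_space borel (A \<times> W))"
    "g \<in> borel_measurable (restrict_space borel (A \<times> W))"
    using assms by (auto simp: regular_on_def)
  have "bounded ((\<lambda>u. f u + c * g u) ` (A \<times> W))"
    using assms bounded_plus_comp[of f "A \<times> W" "\<lambda>u. c * g u"] bounded_scaling[of "g ` (A \<times> W)" c]
    by (simp add: regular_on_def image_image)
  then show ?thesis using assms by (auto simp: regular_on_def intro!: continuous_intros)
qed

lemma regular_on_const_on:
  assumes "\<And>u. u \<in> A \<times> W \<Longrightarrow> f u = c"
  shows "regular_on A W f"
proof -
  have "f \<in> borel_measurable (restrict_space borel (A \<times> W)) \<longleftrightarrow>
      (\<lambda>_. c) \<in> borel_measurable (restrict_space borel (A \<times> W))"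
    by (rule measurable_cong) (auto simp: assms space_restrict_space)
  moreover have "continuous_on A (\<lambda>x. f (x, w)) \<longleftrightarrow> continuous_on A (\<lambda>x. c)" if "w \<in> W" for w
    by (rule continuous_on_cong) (use that assms in auto)
  moreover have "f ` (A \<times> W) \<subseteq> {c}" using assms by blast
  then have "bounded (f ` (A \<times> W))" by (rule bounded_subset[rotated]) simp
  ultimately show ?thesis unfolding regular_on_def by auto
qed

lemma measurable_section:
  assumes f: "f \<in> borel_measurable (restrict_space borel (A \<times> W))" and x: "x \<in> (A :: 'a::euclidean_space set)"
  shows "(\<lambda>w. f (x, w)) \<in> borel_measurable (restrict_space borel (W :: 'b::euclidean_space set))"
proof (rule measurable_compose[OF _ f])
  have "(\<lambda>w. (x, w)) \<in> measurable borel (borel :: ('a \<times> 'b) measure)"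
    by (intro borel_measurable_continuous_onI continuous_intros)
  then show "(\<lambda>w. (x, w)) \<in> measurable (restrict_space borel W) (restrict_space borel (A \<times> W))"
    using x by (intro measurable_restrict_space2 measurable_restrict_space1) (auto simp: space_restrict_space)
qed

text \<open>Along a sequence in \<open>A\<close> converging to a point of \<open>A\<close> the
  integrands converge for each \<open>w\<close>, and a constant dominates them because
  \<open>P\<close> is finite.\<close>

lemma regular_on_integral_continuous:
  assumes P: "finite_measure P" "sets P = sets (restrict_space borel W)" and f: "regular_on A W f"
  shows "continuous_on A (\<lambda>x. \<integral>w. f (x, w) \<partial>P)"
proof -
  interpret finite_measure P by fact
  have sp: "space P = W" using sets_eq_imp_space_eq[OF P(2)] by (simp add: space_restrict_space)
  obtain C where C: "\<And>u. u \<in> A \<times> W \<Longrightarrow> norm (f u) \<le> C"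
    using f by (auto simp: regular_on_def bounded_iff)
  have meas: "(\<lambda>w. f (x, w)) \<in> borel_measurable P" if "x \<in> A" for x
    unfolding measurable_cong_sets[OF P(2) refl]
    using f by (intro measurable_section[OF _ that]) (simp add: regular_on_def)
  show ?thesis
    unfolding continuous_on_sequentially comp_def
  proof (intro allI ballI impI)
    fix xs x assume x: "x \<in> A" and xs: "(\<forall>n. xs n \<in> A) \<and> xs \<longlonglongrightarrow> x"
    show "(\<lambda>n. \<integral>w. f (xs n, w) \<partial>P) \<longlonglongrightarrow> (\<integral>w. f (x, w) \<partial>P)"
    proof (rule integral_dominated_convergence[where w = "\<lambda>_. C"])
      have "(\<lambda>n. f (xs n, w)) \<longlonglongrightarrow> f (x, w)" if "w \<in> W" for w
        using f that x xs continuous_on_sequentially[of A "\<lambda>x. f (x, w)"] by (auto simp: regular_on_def comp_def)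
      then show "AE w in P. (\<lambda>n. f (xs n, w)) \<longlonglongrightarrow> f (x, w)" by (auto simp: sp)
      show "AE w in P. norm (f (xs n, w)) \<le> C" for n using C xs by (auto simp: sp)
    qed (use meas x xs in auto)
  qed
qed

section \<open>Regularity of the posterior\<close>

text \<open>In the update the coefficient of \<open>post_cov K lam d k u (d k)\<close> does not
  depend on \<open>u\<close>, so each new column is a linear combination of two old ones, at
  \<open>v\<close> and at \<open>d k\<close>; hence the induction over all \<open>v\<close>. A zero
  denominator only makes the coefficient 0.\<close>

lemma regular_on_post_cov:
  assumes K: "\<And>v. v \<in> A \<times> W \<Longrightarrow> regular_on A W (\<lambda>u. K u v)"
    and "\<And>i. i < k \<Longrightarrow> d i \<in> A \<times> W" and "v \<in> A \<times> W"
  shows "regular_on A W (\<lambda>u. post_cov K lam d k u v)"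
  using assms(2,3)
proof (induction k arbitrary: v)
  case 0
  then show ?case using K by simp
next
  case (Suc k)
  have "post_cov K lam d (Suc k) u v = post_cov K lam d k u v +
     (- (post_cov K lam d k (d k) v / (post_cov K lam d k (d k) (d k) + lam (d k)))) * post_cov K lam d k u (d k)" for u
    by simp
  moreover have "regular_on A W (\<lambda>u. post_cov K lam d k u v)" "regular_on A W (\<lambda>u. post_cov K lam d k u (d k))"
    using Suc by auto
  ultimately show ?case by (simp only: regular_on_lincomb)
qed

lemma regular_on_post_mean:
  assumes K: "\<And>v. v \<in> A \<times> W \<Longrightarrow> regular_on A W (\<lambda>u. K u v)" and m: "regular_on A W m"
    and "\<And>i. i < k \<Longrightarrow> d i \<in> A \<times> W"
  shows "regular_on A W (post_mean m K lam d y k)"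
  using assms(3)
proof (induction k)
  case 0
  have "post_mean m K lam d y 0 = m" by (rule ext) simp
  then show ?case using m by simp
next
  case (Suc k)
  have "post_mean m K lam d y (Suc k) = (\<lambda>u. post_mean m K lam d y k u +
     ((y k - post_mean m K lam d y k (d k)) / (post_cov K lam d k (d k) (d k) + lam (d k))) * post_cov K lam d k u (d k))"
    by (rule ext) simp
  moreover have "regular_on A W (post_mean m K lam d y k)" "regular_on A W (\<lambda>u. post_cov K lam d k u (d k))"
    using Suc by (auto intro!: regular_on_post_cov K)
  ultimately show ?case by (simp only: regular_on_lincomb)
qed

text \<open>The recursion evaluates the kernel at the random point \<open>d k\<close>, so the
  arguments \<open>u\<close> and \<open>v\<close> must be random too and vary in the induction. The
  space \<open>N\<close> is arbitrary so that it can later be the history as well as its product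
  with the integration variable.\<close>

lemma measurable_post_cov:
  fixes K :: "'t::second_countable_topology \<Rightarrow> 't \<Rightarrow> real"
  assumes K: "(\<lambda>(u, v). K u v) \<in> borel_measurable (restrict_space borel (T \<times> T))"
    and lam: "lam \<in> borel_measurable (restrict_space borel T)"
    and "\<And>i. i < k \<Longrightarrow> d i \<in> measurable N (restrict_space borel T)"
    and "u \<in> measurable N (restrict_space borel T)" "v \<in> measurable N (restrict_space borel T)"
  shows "(\<lambda>\<omega>. post_cov K lam (\<lambda>i. d i \<omega>) k (u \<omega>) (v \<omega>)) \<in> borel_measurable N"
  using assms(3-)
proof (induction k arbitrary: u v)
  case 0
  have uv: "u \<in> measurable N borel" "v \<in> measurable N borel" "\<And>\<omega>. \<omega> \<in> space N \<Longrightarrow> u \<omega> \<in> T \<and> v \<omega> \<in> T"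
    using 0 by (auto simp: measurable_restrict_space2_iff)
  have "(\<lambda>\<omega>. (u \<omega>, v \<omega>)) \<in> measurable N borel"
    using uv by (subst borel_prod[symmetric]) measurable
  then have "(\<lambda>\<omega>. (u \<omega>, v \<omega>)) \<in> measurable N (restrict_space borel (T \<times> T))"
    using uv by (intro measurable_restrict_space2) auto
  from measurable_compose[OF this K] show ?case by simp
next
  case (Suc k)
  have d: "d k \<in> measurable N (restrict_space borel T)" using Suc.prems by auto
  have IH: "(\<lambda>\<omega>. post_cov K lam (\<lambda>i. d i \<omega>) k (u \<omega>) (v \<omega>)) \<in> borel_measurable N"
    if "u \<in> measurable N (restrict_space borel T)" "v \<in> measurable N (restrict_space borel T)" for u v
    using that Suc by auto
  note [measurable] = IH[OF Suc.prems(2,3)] IH[OF Suc.prems(2) d] IH[OF d Suc.prems(3)] IH[OF d d]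
    measurable_compose[OF d lam]
  show ?case by simp
qed

lemma measurable_post_mean:
  fixes K :: "'t::second_countable_topology \<Rightarrow> 't \<Rightarrow> real"
  assumes K: "(\<lambda>(u, v). K u v) \<in> borel_measurable (restrict_space borel (T \<times> T))"
    and lam: "lam \<in> borel_measurable (restrict_space borel T)"
    and m: "m \<in> borel_measurable (restrict_space borel T)"
    and "\<And>i. i < k \<Longrightarrow> d i \<in> measurable N (restrict_space borel T)"
    and "\<And>i. i < k \<Longrightarrow> y i \<in> borel_measurable N"
    and "u \<in> measurable N (restrict_space borel T)"
  shows "(\<lambda>\<omega>. post_mean m K lam (\<lambda>i. d i \<omega>) (\<lambda>i. y i \<omega>) k (u \<omega>)) \<in> borel_measurable N"
  using assms(4-)
proof (induction k arbitrary: u)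
  case 0
  then show ?case using measurable_compose[OF _ m] by simp
next
  case (Suc k)
  have d: "d k \<in> measurable N (restrict_space borel T)" and [measurable]: "y k \<in> borel_measurable N"
    and d': "\<And>i. i < k \<Longrightarrow> d i \<in> measurable N (restrict_space borel T)"
    using Suc.prems by auto
  have IH: "(\<lambda>\<omega>. post_mean m K lam (\<lambda>i. d i \<omega>) (\<lambda>i. y i \<omega>) k (u \<omega>)) \<in> borel_measurable N"
    if "u \<in> measurable N (restrict_space borel T)" for u
    using that Suc by auto
  note [measurable] = IH[OF Suc.prems(3)] IH[OF d] measurable_compose[OF d lam]
    measurable_post_cov[OF K lam d' Suc.prems(3) d] measurable_post_cov[OF K lam d' d d]
  show ?case by simp
qed

section \<open>Histories\<close>

lemma measurable_history:
  fixes X :: "nat \<Rightarrow> 'c \<Rightarrow> 't::topological_space"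
  assumes "i < k"
  shows "X i \<in> measurable (history M X Y k) borel" "Y i \<in> measurable (history M X Y k) borel"
proof -
  have "(\<lambda>\<omega>. \<lambda>i\<in>{..<k}. (X i \<omega>, Y i \<omega>)) \<in> measurable (history M X Y k) (PiM {..<k} (\<lambda>_. borel \<Otimes>\<^sub>M borel))"
    unfolding history_def by (rule measurable_vimage_algebra1) (auto simp: space_PiM space_pair_measure)
  from measurable_compose[OF this measurable_component_singleton[of i]] assms
  have "(\<lambda>\<omega>. (X i \<omega>, Y i \<omega>)) \<in> measurable (history M X Y k) (borel \<Otimes>\<^sub>M borel)" by simp
  from measurable_compose[OF this measurable_fst] measurable_compose[OF this measurable_snd]
  show "X i \<in> measurable (history M X Y k) borel" "Y i \<in> measurable (history M X Y k) borel" by simp_all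
qed

lemma space_history [simp]: "space (history M X Y k) = space M"
  by (simp add: history_def)

lemma subalgebra_history:
  assumes "\<And>i. i < k \<Longrightarrow> X i \<in> measurable M borel" "\<And>i. i < k \<Longrightarrow> Y i \<in> measurable M borel"
  shows "subalgebra M (history M X Y k)"
proof -
  have "(\<lambda>\<omega>. \<lambda>i\<in>{..<k}. (X i \<omega>, Y i \<omega>)) \<in> measurable M (PiM {..<k} (\<lambda>_. borel \<Otimes>\<^sub>M borel))"
    using assms by (intro measurable_restrict measurable_Pair) auto
  then show ?thesis
    unfolding subalgebra_def history_def by (simp add: sets_image_in_sets)
qed

text \<open>An integral with a parameter is measurable once the integrand is jointly measurable. The
  premise on \<open>q\<close> speaks of random points \<open>u\<close> on the product space, which
  is the form in which the posterior is known to be measurable; it is used at the point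
  \<open>(x, snd \<omega>)\<close>.\<close>

lemma measurable_integral_section:
  fixes A :: "'a::euclidean_space set" and W :: "'b::euclidean_space set"
    and q :: "'c \<Rightarrow> 'a \<times> 'b \<Rightarrow> real"
  assumes P: "finite_measure P" "sets P = sets (restrict_space borel W)" and x: "x \<in> A"
    and q: "\<And>u. u \<in> measurable (N \<Otimes>\<^sub>M P) (restrict_space borel (A \<times> W)) \<Longrightarrow>
       (\<lambda>\<omega>. q (fst \<omega>) (u \<omega>)) \<in> borel_measurable (N \<Otimes>\<^sub>M P)"
  shows "(\<lambda>\<omega>. \<integral>w. q \<omega> (x, w) \<partial>P) \<in> borel_measurable N"
proof -
  interpret finite_measure P by fact
  have sp: "space P = W" using sets_eq_imp_space_eq[OF P(2)] by (simp add: space_restrict_space)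
  have "(\<lambda>w. w) \<in> measurable P (restrict_space borel W)"
    by (simp add: measurable_cong_sets[OF P(2) refl])
  then have "(\<lambda>w. w) \<in> measurable P borel" by (simp add: measurable_restrict_space2_iff)
  then have [measurable]: "snd \<in> measurable (N \<Otimes>\<^sub>M P) borel"
    using measurable_compose[OF measurable_snd] by fastforce
  have "(\<lambda>\<omega>. (x, snd \<omega>)) \<in> measurable (N \<Otimes>\<^sub>M P) (borel :: ('a \<times> 'b) measure)"
    by (subst borel_prod[symmetric]) measurable
  then have "(\<lambda>\<omega>. (x, snd \<omega>)) \<in> measurable (N \<Otimes>\<^sub>M P) (restrict_space borel (A \<times> W))"
    using x by (intro measurable_restrict_space2) (auto simp: space_pair_measure sp)
  from q[OF this] show ?thesis
    by (intro borel_measurable_lebesgue_integral) (simp add: split_beta)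
qed

theorem lemma4:
  fixes M :: "'c measure"
    and A :: "'a::euclidean_space set" and W :: "'b::euclidean_space set"
    and p :: "'b \<Rightarrow> real"
    and F :: "'a \<times> 'b \<Rightarrow> 'c \<Rightarrow> real"
    and \<mu>0 :: "'a \<times> 'b \<Rightarrow> real" and \<Sigma>0 :: "'a \<times> 'b \<Rightarrow> 'a \<times> 'b \<Rightarrow> real"
    and lam :: "'a \<times> 'b \<Rightarrow> real"
    and X :: "nat \<Rightarrow> 'c \<Rightarrow> 'a \<times> 'b" and noise :: "nat \<Rightarrow> 'c \<Rightarrow> real"
    and n :: nat and z :: "'a \<times> 'b" and Z :: "'c \<Rightarrow> real"
    and A' :: "nat \<Rightarrow> 'a set"
  defines "Y \<equiv> \<lambda>i \<omega>. F (X i \<omega>) \<omega> + noise i \<omega>"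
  defines "H \<equiv> history M X Y"
  defines "\<mu> \<equiv> \<lambda>k \<omega>. post_mean \<mu>0 \<Sigma>0 lam (\<lambda>i. X i \<omega>) (\<lambda>i. Y i \<omega>) k"
  defines "\<Sigma> \<equiv> \<lambda>k \<omega>. post_cov \<Sigma>0 lam (\<lambda>i. X i \<omega>) k"
  defines "a \<equiv> \<lambda>k \<omega> x. LINT w:W|lebesgue. \<mu> k \<omega> (x, w) * p w"
  defines "\<sigma> \<equiv> \<lambda>\<omega> x.
     if lam z = 0 \<and> (\<exists>i<n. X i \<omega> = z) then 0
     else (LINT w:W|lebesgue. \<Sigma> n \<omega> (x, w) z * p w) / sqrt (\<Sigma> n \<omega> z z + lam z)"
  defines "V \<equiv> \<lambda>\<omega>.
     real_cond_exp M (H n) (\<lambda>\<omega>'. max_over A (a (Suc n) \<omega>')) \<omega> - max_over A (a n \<omega>)"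
  assumes M: "prob_space M"
    and A: "compact A"
    and p_nonneg: "\<And>w. w \<in> W \<Longrightarrow> 0 \<le> p w"
    and p_int: "set_integrable lebesgue W p"
    and prior: "gaussian_process M (A \<times> W) F \<mu>0 \<Sigma>0"
    and \<Sigma>0_meas: "(\<lambda>(u, v). \<Sigma>0 u v) \<in> borel_measurable (restrict_space borel ((A \<times> W) \<times> (A \<times> W)))"
    and lam_nonneg: "\<And>u. u \<in> A \<times> W \<Longrightarrow> 0 \<le> lam u"
    and lam_meas: "lam \<in> borel_measurable (restrict_space borel (A \<times> W))"
    and X_meas: "\<And>i. i \<le> n \<Longrightarrow> X i \<in> borel_measurable M"
    and X_in: "\<And>i \<omega>. i \<le> n \<Longrightarrow> \<omega> \<in> space M \<Longrightarrow> X i \<omega> \<in> A \<times> W"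
    and X_next: "\<And>\<omega>. \<omega> \<in> space M \<Longrightarrow> X n \<omega> = z"
    and Y_meas: "\<And>i. i \<le> n \<Longrightarrow> Y i \<in> borel_measurable M"
    and noise: "\<And>i. i \<le> n \<Longrightarrow>
       has_cond_law M (before_noise M (A \<times> W) F X noise i) (noise i) (\<lambda>\<omega>. normal_law 0 (lam (X i \<omega>)))"
    and posterior: "\<And>k. k \<le> Suc n \<Longrightarrow> gaussian_process_given M (H k) (A \<times> W) F (\<mu> k) (\<Sigma> k)"
    and Z_normal: "has_cond_law M (H n) Z (\<lambda>_. normal_law 0 1)"
    and Z_next: "\<And>x. x \<in> A \<Longrightarrow> AE \<omega> in M. a (Suc n) \<omega> x = a n \<omega> x + \<sigma> \<omega> x * Z \<omega>"
    and \<Sigma>0_cont: "\<And>w w' x'. w \<in> W \<Longrightarrow> w' \<in> W \<Longrightarrow> x' \<in> A \<Longrightarrow>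
       continuous_on A (\<lambda>x. \<Sigma>0 (x, w) (x', w'))"
    and \<Sigma>0_bdd: "bounded ((\<lambda>(u, v). \<Sigma>0 u v) ` ((A \<times> W) \<times> (A \<times> W)))"
    and \<mu>0_const: "\<exists>c. \<forall>u\<in>A \<times> W. \<mu>0 u = c"
    and A'_fin: "\<And>L. finite (A' L)"
    and A'_sub: "\<And>L. A' L \<subseteq> A"
    and A'_inc: "incseq A'"
    and A'_dense: "A \<subseteq> closure (\<Union>L. A' L)"
  shows "AE \<omega> in M.
     (\<lambda>L. real_cond_exp M (H n) (\<lambda>\<omega>'. max_over (A' L) (\<lambda>x. a n \<omega>' x + \<sigma> \<omega>' x * Z \<omega>')) \<omega>
            - max_over (A' L) (a n \<omega>))
       \<longlonglongrightarrow> V \<omega>"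
proof -
  interpret prob_space M by (rule M)
  obtain \<omega>0 where \<omega>0: "\<omega>0 \<in> space M" using not_empty by blast
  \<comment> \<open>A sampled point exists because a probability space is not empty; it shows that
    \<open>A\<close> and \<open>W\<close> are non-empty, as maxima over \<open>A\<close> and the
    choice of \<open>w0\<close> require.\<close>
  have z: "z \<in> A \<times> W" using X_in[of n, OF order_refl \<omega>0] X_next[OF \<omega>0] by simp
  then have A_ne: "A \<noteq> {}" and "snd z \<in> W" by auto
  then obtain P where P: "finite_measure P" "sets P = sets (restrict_space borel W)"
    and P_eq: "\<And>\<phi>. \<phi> \<in> borel_measurable (restrict_space borel W) \<Longrightarrow>
       (LINT w:W|lebesgue. \<phi> w * p w) = (\<integral>w. \<phi> w \<partial>P)"
    using density_measure_exists[OF _ p_nonneg p_int] by metis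
  note max_lim = max_over_dense_tendsto[OF A A_ne _ A'_fin A'_sub A'_inc A'_dense]
  note max_meas = measurable_max_over_compact[OF A A_ne A'_fin A'_sub A'_inc A'_dense]

  \<comment> \<open>Continuity in the candidate \<open>x\<close>, for a fixed outcome\<close>
  have reg_K: "regular_on A W (\<lambda>u. \<Sigma>0 u v)" if v: "v \<in> A \<times> W" for v
  proof -
    have "(\<lambda>u. (u, v)) \<in> measurable borel (borel :: (('a \<times> 'b) \<times> ('a \<times> 'b)) measure)"
      by (intro borel_measurable_continuous_onI continuous_intros)
    then have "(\<lambda>u. (u, v)) \<in> measurable (restrict_space borel (A \<times> W)) (restrict_space borel ((A \<times> W) \<times> (A \<times> W)))"
      using v by (intro measurable_restrict_space2 measurable_restrict_space1) (auto simp: space_restrict_space)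
    from measurable_compose[OF this \<Sigma>0_meas]
    have "(\<lambda>u. \<Sigma>0 u v) \<in> borel_measurable (restrict_space borel (A \<times> W))" by simp
    moreover have "(\<lambda>u. \<Sigma>0 u v) ` (A \<times> W) \<subseteq> (\<lambda>(u, v). \<Sigma>0 u v) ` ((A \<times> W) \<times> (A \<times> W))"
      using v by force
    then have "bounded ((\<lambda>u. \<Sigma>0 u v) ` (A \<times> W))" by (rule bounded_subset[OF \<Sigma>0_bdd])
    moreover have "continuous_on A (\<lambda>x. \<Sigma>0 (x, w) v)" if "w \<in> W" for w
      using \<Sigma>0_cont[OF that, of "snd v" "fst v"] v by (auto simp: mem_Times_iff)
    ultimately show ?thesis by (simp add: regular_on_def)
  qed
  obtain c where "\<And>u. u \<in> A \<times> W \<Longrightarrow> \<mu>0 u = c" using \<mu>0_const by blast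
  then have reg_m: "regular_on A W \<mu>0" by (rule regular_on_const_on)
  have reg_\<mu>: "regular_on A W (\<mu> k \<omega>)" if "k \<le> Suc n" "\<omega> \<in> space M" for k \<omega>
    unfolding \<mu>_def using that X_in by (intro regular_on_post_mean reg_K reg_m) auto
  have reg_\<Sigma>: "regular_on A W (\<lambda>u. \<Sigma> n \<omega> u z)" if "\<omega> \<in> space M" for \<omega>
    unfolding \<Sigma>_def using that X_in z by (intro regular_on_post_cov reg_K) auto
  have a_eq: "a k \<omega> x = (\<integral>w. \<mu> k \<omega> (x, w) \<partial>P)" if "k \<le> Suc n" "\<omega> \<in> space M" "x \<in> A" for k \<omega> x
    unfolding a_def using reg_\<mu>[OF that(1,2)] that(3)
    by (intro P_eq measurable_section) (auto simp: regular_on_def)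
  have \<Sigma>_eq: "(LINT w:W|lebesgue. \<Sigma> n \<omega> (x, w) z * p w) = (\<integral>w. \<Sigma> n \<omega> (x, w) z \<partial>P)"
    if "\<omega> \<in> space M" "x \<in> A" for \<omega> x
    using measurable_section[OF _ that(2), of "\<lambda>u. \<Sigma> n \<omega> u z" W] reg_\<Sigma>[OF that(1)]
    by (intro P_eq) (auto simp: regular_on_def)

  have a_cont: "continuous_on A (a k \<omega>)" if "k \<le> Suc n" "\<omega> \<in> space M" for k \<omega>
    using regular_on_integral_continuous[OF P reg_\<mu>[OF that]]
    by (rule continuous_on_eq) (simp add: a_eq that)
  have \<sigma>_cont: "continuous_on A (\<sigma> \<omega>)" if "\<omega> \<in> space M" for \<omega>
  proof -
    have "continuous_on A (\<lambda>x. LINT w:W|lebesgue. \<Sigma> n \<omega> (x, w) z * p w)"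
      using regular_on_integral_continuous[OF P reg_\<Sigma>[OF that]]
      by (rule continuous_on_eq) (simp add: \<Sigma>_eq that)
    then have cont: "continuous_on A (\<lambda>x. (LINT w:W|lebesgue. \<Sigma> n \<omega> (x, w) z * p w) / sqrt (\<Sigma> n \<omega> z z + lam z))"
      unfolding divide_inverse by (rule continuous_on_mult_right)
    \<comment> \<open>Neither the case distinction nor the denominator involves \<open>x\<close>, so
      for a fixed outcome one branch applies on all of \<open>A\<close>.\<close>
    show ?thesis
    proof (cases "lam z = 0 \<and> (\<exists>i<n. X i \<omega> = z)")
      case True
      show ?thesis unfolding \<sigma>_def if_P[OF True] by (rule continuous_on_const)
    next
      case False
      show ?thesis unfolding \<sigma>_def if_not_P[OF False] by (rule cont)
    qed
  qed

  \<comment> \<open>Measurability with respect to the history\<close>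
  have sub: "subalgebra M (H k)" if "k \<le> Suc n" for k
    unfolding H_def using that X_meas Y_meas by (intro subalgebra_history) auto
  have sp: "space (H k) = space M" for k by (simp add: H_def)
  have X_H: "X i \<in> measurable (H k) (restrict_space borel (A \<times> W))" if "i < k" "k \<le> Suc n" for i k
    using that measurable_history(1)[OF that(1), of X M Y] X_in
    by (intro measurable_restrict_space2) (auto simp: H_def)
  have Y_H: "Y i \<in> borel_measurable (H k)" if "i < k" for i k
    using measurable_history(2)[OF that] by (simp add: H_def)
  have m0: "\<mu>0 \<in> borel_measurable (restrict_space borel (A \<times> W))" using reg_m by (simp add: regular_on_def)

  have a_meas: "(\<lambda>\<omega>. a k \<omega> x) \<in> borel_measurable (H k)" if "k \<le> Suc n" "x \<in> A" for k x
  proof -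
    have "(\<lambda>\<omega>. \<integral>w. \<mu> k \<omega> (x, w) \<partial>P) \<in> borel_measurable (H k)"
    proof (rule measurable_integral_section[OF P that(2)])
      fix u assume "u \<in> measurable (H k \<Otimes>\<^sub>M P) (restrict_space borel (A \<times> W))"
      then show "(\<lambda>\<omega>. \<mu> k (fst \<omega>) (u \<omega>)) \<in> borel_measurable (H k \<Otimes>\<^sub>M P)"
        unfolding \<mu>_def using that(1)
        by (intro measurable_post_mean[OF \<Sigma>0_meas lam_meas m0]
          measurable_compose[OF measurable_fst X_H] measurable_compose[OF measurable_fst Y_H]) auto
    qed
    moreover have "(\<lambda>\<omega>. a k \<omega> x) \<in> borel_measurable (H k) \<longleftrightarrow>
        (\<lambda>\<omega>. \<integral>w. \<mu> k \<omega> (x, w) \<partial>P) \<in> borel_measurable (H k)"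
      by (rule measurable_cong) (use a_eq that sp in auto)
    ultimately show ?thesis by simp
  qed
  have \<sigma>_meas: "(\<lambda>\<omega>. \<sigma> \<omega> x) \<in> borel_measurable (H n)" if x: "x \<in> A" for x
  proof -
    \<comment> \<open>The type of \<open>N\<close> is left open because the constant
      \<open>z\<close> is used both on the history and on its product with \<open>P\<close>.\<close>
    have zc: "(\<lambda>_. z) \<in> measurable N (restrict_space borel (A \<times> W))" for N :: "'d measure"
      using z by (intro measurable_const) (auto simp: space_restrict_space)
    have "(\<lambda>\<omega>. \<integral>w. \<Sigma> n \<omega> (x, w) z \<partial>P) \<in> borel_measurable (H n)"
    proof (rule measurable_integral_section[OF P x])
      fix u assume "u \<in> measurable (H n \<Otimes>\<^sub>M P) (restrict_space borel (A \<times> W))"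
      then show "(\<lambda>\<omega>. \<Sigma> n (fst \<omega>) (u \<omega>) z) \<in> borel_measurable (H n \<Otimes>\<^sub>M P)"
        unfolding \<Sigma>_def
        by (intro measurable_post_cov[OF \<Sigma>0_meas lam_meas, where v = "\<lambda>_. z"]
          measurable_compose[OF measurable_fst X_H] zc) auto
    qed
    moreover have "(\<lambda>\<omega>. LINT w:W|lebesgue. \<Sigma> n \<omega> (x, w) z * p w) \<in> borel_measurable (H n) \<longleftrightarrow>
        (\<lambda>\<omega>. \<integral>w. \<Sigma> n \<omega> (x, w) z \<partial>P) \<in> borel_measurable (H n)"
      by (rule measurable_cong) (use \<Sigma>_eq x sp in auto)
    ultimately have [measurable]:
      "(\<lambda>\<omega>. LINT w:W|lebesgue. \<Sigma> n \<omega> (x, w) z * p w) \<in> borel_measurable (H n)" by simp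
    have [measurable]: "(\<lambda>\<omega>. \<Sigma> n \<omega> z z) \<in> borel_measurable (H n)"
      unfolding \<Sigma>_def
      by (rule measurable_post_cov[OF \<Sigma>0_meas lam_meas, where u = "\<lambda>_. z" and v = "\<lambda>_. z"])
        (use X_H zc in auto)
    have "{\<omega> \<in> space (H n). X i \<omega> = z} \<in> sets (H n)" if "i < n" for i
    proof -
      have "X i \<in> measurable (H n) borel"
        using X_H[OF that] by (auto simp: measurable_restrict_space2_iff)
      from measurable_sets[OF this, of "{z}"] have "X i -` {z} \<inter> space (H n) \<in> sets (H n)" by simp
      also have "X i -` {z} \<inter> space (H n) = {\<omega> \<in> space (H n). X i \<omega> = z}" by blast
      finally show ?thesis .
    qed
    then have "(\<Union>i\<in>{..<n}. {\<omega> \<in> space (H n). X i \<omega> = z}) \<in> sets (H n)"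
      by (intro sets.finite_UN) auto
    also have "(\<Union>i\<in>{..<n}. {\<omega> \<in> space (H n). X i \<omega> = z}) = {\<omega> \<in> space (H n). \<exists>i<n. X i \<omega> = z}"
      by auto
    finally have rep: "{\<omega> \<in> space (H n). \<exists>i<n. X i \<omega> = z} \<in> sets (H n)" .
    have rep': "{\<omega> \<in> space (H n). lam z = 0 \<and> (\<exists>i<n. X i \<omega> = z)} \<in> sets (H n)"
    proof (cases "lam z = 0")
      case True
      show ?thesis using rep unfolding simp_thms True .
    next
      case False
      then have "{\<omega> \<in> space (H n). lam z = 0 \<and> (\<exists>i<n. X i \<omega> = z)} = {}" by blast
      then show ?thesis by (simp only: sets.empty_sets)
    qed
    show ?thesis
      unfolding \<sigma>_def by (rule measurable_If[OF _ _ rep'], measurable)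
  qed

  have subn: "subalgebra M (H n)" by (rule sub) simp
  interpret C: finite_measure_subalgebra M "H n"
    using subn by (simp add: finite_measure_subalgebra_def finite_measure_subalgebra_axioms_def finite_measure_axioms)
  have Z_int: "integrable M Z" using integrable_cond_std_normal[OF subn Z_normal] .
  then have Z_meas [measurable]: "Z \<in> borel_measurable M" by auto

  define b where "b = (\<lambda>\<omega> x. a n \<omega> x + \<sigma> \<omega> x * Z \<omega>)"
  have b_cont: "continuous_on A (b \<omega>)" if "\<omega> \<in> space M" for \<omega>
    unfolding b_def using a_cont[OF _ that, of n] \<sigma>_cont[OF that] by (intro continuous_intros) auto
  have b_meas: "(\<lambda>\<omega>. b \<omega> x) \<in> borel_measurable M" if "x \<in> A" for x
  proof -
    note [measurable] = measurable_from_subalg[OF subn a_meas[of n, OF _ that]]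
      measurable_from_subalg[OF subn \<sigma>_meas[OF that]]
    show ?thesis unfolding b_def by measurable
  qed

  \<comment> \<open>The update formula and the maximum over \<open>A\<close>\<close>
  define D where "D = (\<Union>L. A' L)"
  have D: "countable D" "D \<subseteq> A"
    using A'_fin A'_sub by (auto simp: D_def countable_finite)
  \<comment> \<open>The exceptional null set of the update formula depends on \<open>x\<close>;
    countably many of them still form a null set.\<close>
  have "AE \<omega> in M. \<forall>x\<in>D. a (Suc n) \<omega> x = b \<omega> x"
    using Z_next D by (subst AE_ball_countable[OF D(1)]) (auto simp: b_def)
  then have ab: "AE \<omega> in M. max_over A (a (Suc n) \<omega>) = max_over A (b \<omega>)"
  proof (rule AE_mp, intro AE_I2 impI)
    fix \<omega> assume \<omega>: "\<omega> \<in> space M" and eq: "\<forall>x\<in>D. a (Suc n) \<omega> x = b \<omega> x"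
    \<comment> \<open>Both maxima over \<open>A\<close> are limits of maxima over the
      \<open>A' L\<close>, where the two functions agree.\<close>
    have "(\<lambda>L. max_over (A' L) (a (Suc n) \<omega>)) \<longlonglongrightarrow> max_over A (a (Suc n) \<omega>)"
      using \<omega> by (intro max_lim a_cont) auto
    moreover have "max_over (A' L) (a (Suc n) \<omega>) = max_over (A' L) (b \<omega>)" for L
      using eq by (intro max_over_cong) (auto simp: D_def)
    moreover have "(\<lambda>L. max_over (A' L) (b \<omega>)) \<longlonglongrightarrow> max_over A (b \<omega>)"
      using \<omega> by (intro max_lim b_cont)
    ultimately show "max_over A (a (Suc n) \<omega>) = max_over A (b \<omega>)"
      using LIMSEQ_unique by simp
  qed
  have maxb_meas: "(\<lambda>\<omega>. max_over A (b \<omega>)) \<in> borel_measurable M"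
    by (rule max_meas) (use b_cont b_meas in auto)
  have maxa_meas: "(\<lambda>\<omega>. max_over A (a (Suc n) \<omega>)) \<in> borel_measurable M"
    by (rule max_meas) (use a_cont measurable_from_subalg[OF sub a_meas] in auto)
  have V_eq: "AE \<omega> in M. V \<omega> = real_cond_exp M (H n) (\<lambda>\<omega>. max_over A (b \<omega>)) \<omega> - max_over A (a n \<omega>)"
    using C.real_cond_exp_cong[OF ab maxa_meas maxb_meas] unfolding V_def by eventually_elim simp

  \<comment> \<open>Domination and passage to the limit\<close>
  obtain L0 where L0: "A' L0 \<noteq> {}"
    using A_ne A'_dense by fastforce
  \<comment> \<open>The first sets may be empty, and their unspecified maxima need satisfy neither
    monotonicity nor the bound; the sequence is therefore shifted by \<open>L0\<close>.\<close>
  have ne: "A' (i + L0) \<noteq> {}" for i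
    using L0 A'_inc by (metis incseqD le_add2 subset_empty)
  \<comment> \<open>Adding the two coefficients separates the history from \<open>Z\<close>, since
    \<open>|a| + |\<sigma>| |Z| \<le> (|a| + |\<sigma>|) (1 + |Z|)\<close>. Taking the maximum over
    \<open>A\<close> makes the bound the same for every \<open>L\<close>.\<close>
  define s where "s = (\<lambda>\<omega>. max_over A (\<lambda>x. \<bar>a n \<omega> x\<bar> + \<bar>\<sigma> \<omega> x\<bar>))"
  have s_cont: "continuous_on A (\<lambda>x. \<bar>a n \<omega> x\<bar> + \<bar>\<sigma> \<omega> x\<bar>)" if "\<omega> \<in> space M" for \<omega>
    using a_cont[OF _ that, of n] \<sigma>_cont[OF that] by (intro continuous_intros) auto
  have s_meas: "s \<in> borel_measurable (H n)"
    unfolding s_def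
  proof (rule max_meas)
    show "(\<lambda>\<omega>. \<bar>a n \<omega> x\<bar> + \<bar>\<sigma> \<omega> x\<bar>) \<in> borel_measurable (H n)" if "x \<in> A" for x
      using a_meas[of n x] \<sigma>_meas[of x] that by measurable
  qed (simp add: s_cont sp)
  have b_bound: "\<bar>b \<omega> x\<bar> \<le> s \<omega> * (1 + \<bar>Z \<omega>\<bar>)" if \<omega>: "\<omega> \<in> space M" and x: "x \<in> A" for \<omega> x
  proof -
    have "\<bar>a n \<omega> x\<bar> + \<bar>\<sigma> \<omega> x\<bar> \<le> s \<omega>"
      using max_over_attained[OF A A_ne s_cont[OF \<omega>]] x unfolding s_def by metis
    then have "(\<bar>a n \<omega> x\<bar> + \<bar>\<sigma> \<omega> x\<bar>) * (1 + \<bar>Z \<omega>\<bar>) \<le> s \<omega> * (1 + \<bar>Z \<omega>\<bar>)"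
      by (intro mult_right_mono) auto
    moreover have "\<bar>b \<omega> x\<bar> \<le> \<bar>a n \<omega> x\<bar> + \<bar>\<sigma> \<omega> x\<bar> * \<bar>Z \<omega>\<bar>"
      unfolding b_def abs_mult[symmetric] by (rule abs_triangle_ineq)
    moreover have "\<bar>a n \<omega> x\<bar> + \<bar>\<sigma> \<omega> x\<bar> * \<bar>Z \<omega>\<bar> \<le> (\<bar>a n \<omega> x\<bar> + \<bar>\<sigma> \<omega> x\<bar>) * (1 + \<bar>Z \<omega>\<bar>)"
      by (simp add: algebra_simps)
    ultimately show ?thesis by linarith
  qed
  have "AE \<omega> in M. (\<lambda>i. real_cond_exp M (H n) (\<lambda>\<omega>. max_over (A' (i + L0)) (b \<omega>)) \<omega>)
      \<longlonglongrightarrow> real_cond_exp M (H n) (\<lambda>\<omega>. max_over A (b \<omega>)) \<omega>"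
  \<comment> \<open>Here \<open>s\<close> is the factor measurable with respect to
    \<open>H n\<close>, and \<open>1 + |Z|\<close> is the integrable one.\<close>
  proof (rule C.real_cond_exp_incseq_tendsto_local[OF _ _ _ s_meas])
    show "(\<lambda>\<omega>. max_over (A' (i + L0)) (b \<omega>)) \<in> borel_measurable M" for i
      using A'_sub b_meas by (intro measurable_max_over_finite A'_fin) auto
    show "incseq (\<lambda>i. max_over (A' (i + L0)) (b \<omega>))" for \<omega>
      using A'_inc by (intro incseq_SucI max_over_mono_set A'_fin ne) (auto simp: incseq_Suc_iff)
    show "(\<lambda>i. max_over (A' (i + L0)) (b \<omega>)) \<longlonglongrightarrow> max_over A (b \<omega>)" if "\<omega> \<in> space M" for \<omega>
      using max_lim[OF b_cont[OF that]] by (rule LIMSEQ_ignore_initial_segment)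
    show "integrable M (\<lambda>\<omega>. 1 + \<bar>Z \<omega>\<bar>)" using Z_int by auto
    show "\<bar>max_over (A' (i + L0)) (b \<omega>)\<bar> \<le> s \<omega> * (1 + \<bar>Z \<omega>\<bar>)" if "\<omega> \<in> space M" for i \<omega>
      using max_over_finite_attained[OF A'_fin ne[of i], of "b \<omega>"] b_bound[OF that] A'_sub by (metis subsetD)
  qed auto
  then show ?thesis using V_eq AE_space
  proof eventually_elim
    case (elim \<omega>)
    \<comment> \<open>The shift by \<open>L0\<close> is undone: finitely many initial terms do not
      affect the limit.\<close>
    have "(\<lambda>L. real_cond_exp M (H n) (\<lambda>\<omega>. max_over (A' L) (b \<omega>)) \<omega>)
        \<longlonglongrightarrow> real_cond_exp M (H n) (\<lambda>\<omega>. max_over A (b \<omega>)) \<omega>"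
      using elim(1) by (rule LIMSEQ_offset)
    moreover have "(\<lambda>L. max_over (A' L) (a n \<omega>)) \<longlonglongrightarrow> max_over A (a n \<omega>)"
      using elim(3) by (intro max_lim a_cont) auto
    ultimately show ?case unfolding elim(2) b_def by (rule tendsto_diff)
  qed
qed

end
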